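(* Let $m_n$ denote the classifier $$m_n(x)=\lim_{L\to\infty}\operatorname{sign}\Big(y\,\big(K_n^{(L)}\big)^{-1}K^{(L)}(X,x)\Big)$$ corresponding to training an infinitely wide and deep network with activation function $\phi$ on $n$ training examples $(x^{(i)},y^{(i)})\in\mathcal{S}_+^d\times\{-1,1\}$, where $K^{(L)}$ is the NTK (see context). For any $x,\tilde{x}\in\mathcal{S}_+^{d}$ with $x\neq\tilde{x}$, if the NTK $K^{(L)}$ satisfies $$\lim_{L\to\infty}\frac{K^{(L)}(x,\tilde{x})}{C(L)}=C_1\qquad\text{and}\qquad \lim_{L\to\infty}\frac{K^{(L)}(x,\tilde{x})}{C(L)}\neq\lim_{L\to\infty}\frac{K^{(L)}(x,x)}{C(L)},$$ with $C_1>0$ and $0<C(L)<\infty$ for any $L$, then $m_n$ implements the majority vote classifier, i.e., $$m_n(x)=\operatorname{sign}\Big(\sum_{i=1}^{n}y^{(i)}\Big).$$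
   Context: $\mathcal{S}_+^{d}$ is the intersection of the unit sphere $\mathcal{S}^d\subset\mathbb{R}^{d+1}$ with the non-negative orthant; training data are taken to have a density on $\mathcal{S}_+^d$. Activation function: $\phi:\mathbb{R}\to\mathbb{R}$ with derivative $\phi'$, with $\mathbb{E}[\phi(z)^2]=1$ (normalization) and $\mathbb{E}[\phi'(z)^2]<\infty$ for $z\sim\mathcal{N}(0,1)$. Dual activation: $\check{\phi}:[-1,1]\to\mathbb{R}$, $\check{\phi}(z)=\mathbb{E}[\phi(u)\phi(v)]$ where $(u,v)$ is a centered Gaussian vector with covariance $\begin{pmatrix} 1 & z \\ z & 1 \end{pmatrix}$; $\check{\phi}'$ is its derivative. Write $\check{\phi}^{(0)}(z)=z$ and $\check{\phi}^{(L)}=\check{\phi}\circ\check{\phi}^{(L-1)}$. Neural Tangent Kernel (NTK) of the (infinitely wide, bias-free) fully connected network with $L$ hidden layers and activation $\phi$, on the unit sphere: $K^{(L)}(x,\tilde{x})=K^{(L)}(z)$ with $z=x^T\tilde{x}$, where $$K^{(0)}(z)=z,\qquad K^{(L)}(z)=\check{\phi}^{(L)}(z)+K^{(L-1)}(z)\,\check{\phi}'\big(\check{\phi}^{(L-1)}(z)\big).$$ Kernel machine notation: $X=[x^{(1)}|\dots|x^{(n)}]$, $y=[y^{(1)},\dots,y^{(n)}]\in\{-1,1\}^{1\times n}$, $(K_n^{(L)})_{i,j}=K^{(L)}(x^{(i)},x^{(j)})$, and $K^{(L)}(X,x)\in\mathbb{R}^n$ with $i$-th entry $K^{(L)}(x^{(i)},x)$.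 Majority vote classifier: the prediction on a new sample is the label of the class with greater representation in the training set.
   Formalization: Assumes the training points are distinct, x is not a training point, and the labels are not tied (sum of y^(i) is nonzero); at a training point the classifier returns that point's label, and in a tie it is generally ±1 rather than sign(0), so the formula fails there. *)

theory Defs
  imports "HOL-Probability.Probability"
begin

text \<open>
  The law of \<open>(u, v) = (g, z g + sqrt (1 - z\<^sup>2) h)\<close> for independent standard normal \<open>g\<close>, \<open>h\<close>.
  For \<open>\<bar>z\<bar> \<le> 1\<close> it is the centred Gaussian law on the plane with covariance
  matrix \<open>((1, z), (z, 1))\<close>, degenerate cases \<open>z = 1\<close>, \<open>z = -1\<close> included; the lemma below
  confirms this through its characteristic function.
\<close>

definition gaussian_pair :: "real \<Rightarrow> (real \<times> real) measure" where
  "gaussian_pair z =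
     distr (std_normal_distribution \<Otimes>\<^sub>M std_normal_distribution) borel
       (\<lambda>(g, h). (g, z * g + sqrt (1 - z\<^sup>2) * h))"

lemma char_gaussian_pair:
  fixes z s t :: real
  assumes z: "\<bar>z\<bar> \<le> 1"
  shows "(\<integral>p. exp (\<i> * complex_of_real (s * fst p + t * snd p)) \<partial>gaussian_pair z)
    = complex_of_real (exp (- (s\<^sup>2 * 1 + 2 * s * t * z + t\<^sup>2 * 1) / 2))"
proof -
  let ?N = "std_normal_distribution"
  let ?c = "sqrt (1 - z\<^sup>2)"
  interpret N: real_distribution ?N by (rule real_dist_normal_dist)
  interpret P: pair_prob_space ?N ?N ..
  have c2: "?c\<^sup>2 = 1 - z\<^sup>2"
    using z by (simp add: abs_square_le_1)
  have meas: "(\<lambda>(g, h). (g, z * g + ?c * h)) \<in> borel_measurable (?N \<Otimes>\<^sub>M ?N)"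
    by measurable
  have char: "(\<integral>g. exp (\<i> * complex_of_real (a * g)) \<partial>?N) = complex_of_real (exp (- (a\<^sup>2) / 2))" for a
    using char_std_normal_distribution[THEN fun_cong, of a] by (simp add: char_def)
  have "(\<integral>p. exp (\<i> * complex_of_real (s * fst p + t * snd p)) \<partial>gaussian_pair z)
      = (\<integral>(g, h). exp (\<i> * complex_of_real (s * g + t * (z * g + ?c * h))) \<partial>(?N \<Otimes>\<^sub>M ?N))"
    unfolding gaussian_pair_def
    by (subst integral_distr[OF meas])
       (auto simp: case_prod_beta' intro!: borel_measurable_continuous_onI continuous_intros)
  also have "\<dots> = (\<integral>(g, h). exp (\<i> * complex_of_real ((s + t * z) * g)) *
                   exp (\<i> * complex_of_real ((t * ?c) * h)) \<partial>(?N \<Otimes>\<^sub>M ?N))"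
    by (simp add: case_prod_beta' exp_add[symmetric] algebra_simps)
  also have "\<dots> = (\<integral>g. (\<integral>h. exp (\<i> * complex_of_real ((s + t * z) * g)) *
                   exp (\<i> * complex_of_real ((t * ?c) * h)) \<partial>?N) \<partial>?N)"
  proof -
    let ?F = "\<lambda>(g, h). exp (\<i> * complex_of_real ((s + t * z) * g)) *
        exp (\<i> * complex_of_real ((t * ?c) * h))"
    have "?F \<in> borel_measurable (?N \<Otimes>\<^sub>M ?N)"
      by measurable
    then have "integrable (?N \<Otimes>\<^sub>M ?N) ?F"
      by (intro P.integrable_const_bound[where B = 1]) (auto simp: norm_mult)
    from P.integral_fst'[OF this] show ?thesis
      by simp
  qed
  also have "\<dots> = complex_of_real (exp (- ((s + t * z)\<^sup>2) / 2)) * complex_of_real (exp (- ((t * ?c)\<^sup>2) / 2))"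
    unfolding integral_mult_right_zero integral_mult_left_zero char ..
  also have "\<dots> = complex_of_real (exp (- ((s + t * z)\<^sup>2 + (t * ?c)\<^sup>2) / 2))"
    by (simp add: exp_add[symmetric] add_divide_distrib flip: of_real_mult)
  also have "(s + t * z)\<^sup>2 + (t * ?c)\<^sup>2 = s\<^sup>2 * 1 + 2 * s * t * z + t\<^sup>2 * 1"
    unfolding power_mult_distrib c2 by (simp add: power2_eq_square algebra_simps)
  finally show ?thesis .
qed

definition dual_activation :: "(real \<Rightarrow> real) \<Rightarrow> real \<Rightarrow> real" where
  "dual_activation \<phi> z = (\<integral>p. \<phi> (fst p) * \<phi> (snd p) \<partial>gaussian_pair z)"

text \<open>
  The dual activation is a function on \<open>[-1, 1]\<close>, so its derivative is one-sided at the
  endpoints.  The value at \<open>1\<close> enters every diagonal entry of the kernel matrix.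
\<close>

definition dual_activation_deriv :: "(real \<Rightarrow> real) \<Rightarrow> real \<Rightarrow> real" where
  "dual_activation_deriv \<phi> z = vector_derivative (dual_activation \<phi>) (at z within {-1..1})"

primrec ntk :: "(real \<Rightarrow> real) \<Rightarrow> nat \<Rightarrow> real \<Rightarrow> real" where
  "ntk \<phi> 0 z = z"
| "ntk \<phi> (Suc L) z =
     (dual_activation \<phi> ^^ Suc L) z
       + ntk \<phi> L z * dual_activation_deriv \<phi> ((dual_activation \<phi> ^^ L) z)"

definition ntk_matrix ::
  "(real \<Rightarrow> real) \<Rightarrow> nat \<Rightarrow> ('n::finite \<Rightarrow> real ^ 'd::finite) \<Rightarrow> real ^ 'n ^ 'n" where
  "ntk_matrix \<phi> L X = (\<chi> i j. ntk \<phi> L (X i \<bullet> X j))"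

definition ntk_vector ::
  "(real \<Rightarrow> real) \<Rightarrow> nat \<Rightarrow> ('n::finite \<Rightarrow> real ^ 'd::finite) \<Rightarrow> real ^ 'd \<Rightarrow> real ^ 'n" where
  "ntk_vector \<phi> L X x = (\<chi> i. ntk \<phi> L (X i \<bullet> x))"

definition ntk_sign ::
  "(real \<Rightarrow> real) \<Rightarrow> ('n::finite \<Rightarrow> real ^ 'd::finite) \<Rightarrow> real ^ 'n \<Rightarrow> real ^ 'd \<Rightarrow> nat \<Rightarrow> real" where
  "ntk_sign \<phi> X y x L =
     sgn ((y v* matrix_inv (ntk_matrix \<phi> L X)) \<bullet> ntk_vector \<phi> L X x)"

definition ntk_classifier ::
  "(real \<Rightarrow> real) \<Rightarrow> ('n::finite \<Rightarrow> real ^ 'd::finite) \<Rightarrow> real ^ 'n \<Rightarrow> real ^ 'd \<Rightarrow> real" where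
  "ntk_classifier \<phi> X y x = lim (ntk_sign \<phi> X y x)"

definition nonneg_sphere :: "(real ^ 'd::finite) set" where
  "nonneg_sphere = {x \<in> sphere 0 1. \<forall>i. 0 \<le> x $ i}"

end

theory Submission
  imports Defs
begin

text \<open>
  The only analytic input needed is that \<open>K L 1 \<ge> 1\<close> for all \<open>L\<close>. As the dual activation fixes
  \<open>1\<close>, this reduces to showing that its one-sided derivative at \<open>1\<close> exists and equals
  \<open>D = E[\<phi>'(g)\<^sup>2] \<ge> 0\<close>. Writing \<open>z = cos \<theta>\<close>, the defect \<open>2 - 2 \<cdot> dual z\<close> is
  \<open>E[(\<phi> (cos \<theta> g + sin \<theta> h) - \<phi> g)\<^sup>2]\<close>. Cauchy-Schwarz along the circular arc from \<open>g\<close>, together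
  with the rotation invariance of the Gaussian law of \<open>(g, h)\<close>, bounds it by \<open>\<theta>\<^sup>2 D\<close>; Fatou's
  lemma gives the matching lower bound as \<open>\<theta> \<rightarrow> 0\<close>.

  Consequently the limit \<open>C2\<close> of the rescaled diagonal is nonnegative. If it is finite and there
  are at least two training points, the rescaled kernel matrix tends to \<open>(C2 - C1) I + C1 J\<close> with
  \<open>J\<close> the all-ones matrix; this is invertible and has the all-ones vector as an eigenvector with positive
  eigenvalue. Otherwise the matrix divided by its diagonal entry tends to \<open>I\<close>. In both cases
  the classifier sees a positive multiple of \<open>\<Sum>i. y i\<close> in the limit.
\<close>

section \<open>Rotation invariance of the standard Gaussian law on the plane\<close>

text \<open>Passing to Lebesgue measure with an explicit density allows affine substitutions in one
  coordinate at a time.\<close>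

lemma nn_integral_std_normal_pair:
  assumes [measurable]: "f \<in> borel_measurable (borel \<Otimes>\<^sub>M borel)"
  shows "(\<integral>\<^sup>+p. f p \<partial>(std_normal_distribution \<Otimes>\<^sub>M std_normal_distribution)) =
    (\<integral>\<^sup>+g. \<integral>\<^sup>+h. ennreal (std_normal_density g * std_normal_density h) * f (g, h) \<partial>lborel \<partial>lborel)"
proof -
  interpret N: real_distribution std_normal_distribution by (rule real_dist_normal_dist)
  have "(\<integral>\<^sup>+p. f p \<partial>(std_normal_distribution \<Otimes>\<^sub>M std_normal_distribution)) =
    (\<integral>\<^sup>+g. \<integral>\<^sup>+h. f (g, h) \<partial>std_normal_distribution \<partial>std_normal_distribution)"
    by (rule N.nn_integral_fst[symmetric]) simp
  also have "\<dots> = (\<integral>\<^sup>+g. ennreal (std_normal_density g) *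
      (\<integral>\<^sup>+h. ennreal (std_normal_density h) * f (g, h) \<partial>lborel) \<partial>lborel)"
    by (simp add: nn_integral_density)
  also have "\<dots> = (\<integral>\<^sup>+g. \<integral>\<^sup>+h. ennreal (std_normal_density g * std_normal_density h) * f (g, h) \<partial>lborel \<partial>lborel)"
    by (subst nn_integral_cmult[symmetric]) (auto simp: ennreal_mult mult.assoc)
  finally show ?thesis .
qed

text \<open>Makes the rotational symmetry of the joint density visible: only
  \<open>g\<^sup>2 + h\<^sup>2\<close> enters.\<close>

lemma std_normal_density_mult:
  "std_normal_density g * std_normal_density h = exp (- (g\<^sup>2 + h\<^sup>2) / 2) / (2 * pi)"
proof -
  have "sqrt (2 * pi) * sqrt (2 * pi) = 2 * pi" by simp
  then show ?thesis
    by (simp add: std_normal_density_def add_divide_distrib mult_exp_exp del: real_sqrt_mult)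
qed

text \<open>The rotation is split into two one-dimensional affine substitutions with Fubini in
  between. First \<open>h\<close> is replaced by \<open>v = c * g + s * h\<close>, then
  \<open>g\<close> by \<open>w\<close> through \<open>g = c * v - s * w\<close>. The Jacobians
  \<open>1 / \<bar>s\<bar>\<close> and \<open>\<bar>s\<bar>\<close> cancel, and the density keeps
  its value since \<open>c\<^sup>2 + s\<^sup>2 = 1\<close>.\<close>

lemma nn_integral_std_normal_rotate:
  assumes [measurable]: "f \<in> borel_measurable (borel \<Otimes>\<^sub>M borel)"
    and cs: "c\<^sup>2 + s\<^sup>2 = (1::real)" and s: "s \<noteq> 0"
  shows "(\<integral>\<^sup>+p. f (c * fst p + s * snd p, c * snd p - s * fst p)
      \<partial>(std_normal_distribution \<Otimes>\<^sub>M std_normal_distribution)) =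
    (\<integral>\<^sup>+p. f p \<partial>(std_normal_distribution \<Otimes>\<^sub>M std_normal_distribution))"
proof -
  let ?n = std_normal_density
  define d where "d g h = ennreal (?n g * ?n h)" for g h
  have d [measurable (raw)]: "(\<lambda>x. d (u x) (v x)) \<in> borel_measurable M"
    if "u \<in> borel_measurable M" "v \<in> borel_measurable M" for u v and M :: "'z measure"
    using that unfolding d_def by measurable
  have f [measurable (raw)]: "(\<lambda>x. f (u x, v x)) \<in> borel_measurable M"
    if "u \<in> borel_measurable M" "v \<in> borel_measurable M" for u v and M :: "'z measure"
    using that by measurable
  have "(\<integral>\<^sup>+p. f (c * fst p + s * snd p, c * snd p - s * fst p)
      \<partial>(std_normal_distribution \<Otimes>\<^sub>M std_normal_distribution))
      = (\<integral>\<^sup>+g. \<integral>\<^sup>+h. d g h * f (c * g + s * h, c * h - s * g) \<partial>lborel \<partial>lborel)"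
    unfolding d_def by (subst nn_integral_std_normal_pair) simp_all
  also have "\<dots> = (\<integral>\<^sup>+g. \<integral>\<^sup>+v. ennreal \<bar>1 / s\<bar> * (d g ((v - c * g) / s) * f (v, c * ((v - c * g) / s) - s * g)) \<partial>lborel \<partial>lborel)"
  proof (rule nn_integral_cong)
    fix g :: real
    have "(\<integral>\<^sup>+h. d g h * f (c * g + s * h, c * h - s * g) \<partial>lborel)
      = ennreal \<bar>1 / s\<bar> * (\<integral>\<^sup>+v. d g (- c * g / s + 1 / s * v) *
          f (c * g + s * (- c * g / s + 1 / s * v), c * (- c * g / s + 1 / s * v) - s * g) \<partial>lborel)"
      using s by (intro nn_integral_real_affine) auto
    also have "\<dots> = ennreal \<bar>1 / s\<bar> * (\<integral>\<^sup>+v. d g ((v - c * g) / s) * f (v, c * ((v - c * g) / s) - s * g) \<partial>lborel)"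
    proof (rule arg_cong[where f = "(*) (ennreal \<bar>1 / s\<bar>)"], rule nn_integral_cong)
      fix v
      have e: "- c * g / s + 1 / s * v = (v - c * g) / s" by (simp add: diff_divide_distrib)
      show "d g (- c * g / s + 1 / s * v) *
          f (c * g + s * (- c * g / s + 1 / s * v), c * (- c * g / s + 1 / s * v) - s * g) =
          d g ((v - c * g) / s) * f (v, c * ((v - c * g) / s) - s * g)"
        unfolding e using s by simp
    qed
    finally show "(\<integral>\<^sup>+h. d g h * f (c * g + s * h, c * h - s * g) \<partial>lborel) =
       (\<integral>\<^sup>+v. ennreal \<bar>1 / s\<bar> * (d g ((v - c * g) / s) * f (v, c * ((v - c * g) / s) - s * g)) \<partial>lborel)"
      by (subst nn_integral_cmult) auto
  qed
  also have "\<dots> = (\<integral>\<^sup>+v. \<integral>\<^sup>+g. ennreal \<bar>1 / s\<bar> * (d g ((v - c * g) / s) * f (v, c * ((v - c * g) / s) - s * g)) \<partial>lborel \<partial>lborel)"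
    by (rule lborel_pair.Fubini') measurable
  also have "\<dots> = (\<integral>\<^sup>+v. \<integral>\<^sup>+w. d v w * f (v, w) \<partial>lborel \<partial>lborel)"
  proof (rule nn_integral_cong)
    fix v :: real
    have "(\<integral>\<^sup>+g. ennreal \<bar>1 / s\<bar> * (d g ((v - c * g) / s) * f (v, c * ((v - c * g) / s) - s * g)) \<partial>lborel)
      = ennreal \<bar>- s\<bar> * (\<integral>\<^sup>+w. ennreal \<bar>1 / s\<bar> * (d (c * v + - s * w) ((v - c * (c * v + - s * w)) / s) *
          f (v, c * ((v - c * (c * v + - s * w)) / s) - s * (c * v + - s * w))) \<partial>lborel)"
      using s by (intro nn_integral_real_affine) auto
    also have "\<dots> = ennreal \<bar>- s\<bar> * (\<integral>\<^sup>+w. ennreal \<bar>1 / s\<bar> * (d v w * f (v, w)) \<partial>lborel)"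
    proof (rule arg_cong[where f = "(*) (ennreal \<bar>- s\<bar>)"], rule nn_integral_cong)
      fix w
      have "v - c * (c * v + - s * w) = s * (s * v + c * w)"
        using cs by algebra
      then have e: "(v - c * (c * v + - s * w)) / s = s * v + c * w" using s by simp
      have e2: "c * (s * v + c * w) - s * (c * v + - s * w) = w"
        using cs by algebra
      have "(c * v + - s * w)\<^sup>2 + (s * v + c * w)\<^sup>2 = (c\<^sup>2 + s\<^sup>2) * (v\<^sup>2 + w\<^sup>2)"
        by (simp add: power2_eq_square algebra_simps)
      then have e3: "d (c * v + - s * w) (s * v + c * w) = d v w"
        unfolding d_def std_normal_density_mult by (simp add: cs)
      show "ennreal \<bar>1 / s\<bar> * (d (c * v + - s * w) ((v - c * (c * v + - s * w)) / s) *
          f (v, c * ((v - c * (c * v + - s * w)) / s) - s * (c * v + - s * w))) =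
          ennreal \<bar>1 / s\<bar> * (d v w * f (v, w))"
        unfolding e e2 e3 ..
    qed
    also have "\<dots> = (\<integral>\<^sup>+w. ennreal \<bar>- s\<bar> * (ennreal \<bar>1 / s\<bar> * (d v w * f (v, w))) \<partial>lborel)"
      by (rule nn_integral_cmult[symmetric]) simp
    also have "\<dots> = (\<integral>\<^sup>+w. d v w * f (v, w) \<partial>lborel)"
      using s by (simp add: mult.assoc[symmetric] ennreal_mult[symmetric])
    finally show "(\<integral>\<^sup>+g. ennreal \<bar>1 / s\<bar> * (d g ((v - c * g) / s) * f (v, c * ((v - c * g) / s) - s * g)) \<partial>lborel)
      = (\<integral>\<^sup>+w. d v w * f (v, w) \<partial>lborel)" .
  qed
  also have "\<dots> = (\<integral>\<^sup>+p. f p \<partial>(std_normal_distribution \<Otimes>\<^sub>M std_normal_distribution))"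
    unfolding d_def by (subst nn_integral_std_normal_pair) simp_all
  finally show ?thesis .
qed

section \<open>Increments of a function along a circular arc\<close>

text \<open>Cauchy-Schwarz for an increment. If the energy is finite, the fundamental theorem of
  calculus for the gauge integral, which tolerates the finite exceptional set \<open>S\<close>,
  writes \<open>F b - F a\<close> as the integral of \<open>F'\<close>.\<close>

lemma square_increment_le_energy:
  fixes F F' :: "real \<Rightarrow> real"
  assumes "finite S" and ab: "a \<le> b" and cont: "continuous_on {a..b} F"
    and deriv: "\<And>t. t \<in> {a<..<b} - S \<Longrightarrow> (F has_real_derivative F' t) (at t)"
    and [measurable]: "(\<lambda>t. (F' t)\<^sup>2) \<in> borel_measurable borel"
  shows "ennreal ((F b - F a)\<^sup>2) \<le>
    ennreal (b - a) * (\<integral>\<^sup>+t. indicator {a..b} t * ennreal ((F' t)\<^sup>2) \<partial>lborel)"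
proof (cases "a = b")
  case False
  then have lt: "a < b" using ab by simp
  let ?I = "\<integral>\<^sup>+t. indicator {a..b} t * ennreal ((F' t)\<^sup>2) \<partial>lborel"
  show ?thesis
  proof (cases "?I = \<infinity>")
    case True
    then show ?thesis using lt by (simp add: ennreal_mult_top)
  next
    case fin: False
    have eq: "?I = (\<integral>\<^sup>+t. ennreal (indicator {a..b} t *\<^sub>R (F' t)\<^sup>2) \<partial>lborel)"
      by (intro nn_integral_cong) (auto split: split_indicator)
    have int: "set_integrable lborel {a..b} (\<lambda>t. (F' t)\<^sup>2)"
      unfolding set_integrable_def
      by (rule integrableI_nonneg) (use fin eq in \<open>auto simp: less_top\<close>)
    define J where "J = integral {a..b} (\<lambda>t. (F' t)\<^sup>2)"
    have hk: "((\<lambda>t. (F' t)\<^sup>2) has_integral J) {a..b}"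
      unfolding J_def using set_borel_integral_eq_integral(1)[OF int] by blast
    have "?I = ennreal (LINT t:{a..b}|lborel. (F' t)\<^sup>2)"
      unfolding eq set_lebesgue_integral_def
      by (rule nn_integral_eq_integral) (use int in \<open>auto simp: set_integrable_def\<close>)
    then have IJ: "?I = ennreal J"
      unfolding J_def using set_borel_integral_eq_integral(2)[OF int] by simp
    have J0: "0 \<le> J" using hk by (rule has_integral_nonneg) simp
    have ftc: "(F' has_integral (F b - F a)) {a..b}"
      using assms by (intro fundamental_theorem_of_calculus_interior_strong[of S])
        (auto simp: has_real_derivative_iff_has_vector_derivative)
    define D where "D = F b - F a"
    \<comment> \<open>Integrate \<open>(F' - D / (b - a))\<^sup>2 \<ge> 0\<close>; this avoids measurability of \<open>F'\<close>.\<close>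
    define m where "m = D / (b - a)"
    have "((\<lambda>t. (F' t)\<^sup>2 - (2 * m) * F' t + m\<^sup>2) has_integral
        (J - (2 * m) * D + (b - a) * m\<^sup>2)) {a..b}"
      using has_integral_add[OF has_integral_diff[OF hk has_integral_mult_right[OF ftc, of "2 * m"]]
          has_integral_const_real[of "m\<^sup>2" a b]] lt
      unfolding D_def[symmetric] by simp
    then have "0 \<le> J - (2 * m) * D + (b - a) * m\<^sup>2"
    proof (rule has_integral_nonneg)
      fix t
      show "0 \<le> (F' t)\<^sup>2 - (2 * m) * F' t + m\<^sup>2"
        using zero_le_power2[of "F' t - m"] by (simp only: power2_diff) (simp add: algebra_simps)
    qed
    moreover have D_eq: "D = (b - a) * m" using lt by (simp add: m_def)
    ultimately have "(b - a) * m\<^sup>2 \<le> J" by (simp add: power2_eq_square algebra_simps)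
    then have "(b - a) * ((b - a) * m\<^sup>2) \<le> (b - a) * J"
      using lt by (intro mult_left_mono) auto
    then have "D\<^sup>2 \<le> (b - a) * J"
      unfolding D_eq by (simp add: power2_eq_square ac_simps)
    then have "ennreal (D\<^sup>2) \<le> ennreal (b - a) * ennreal J"
      using lt J0 by (simp add: ennreal_mult[symmetric] ennreal_leI)
    then show ?thesis unfolding IJ D_def .
  qed
qed simp

text \<open>Squaring \<open>sin t * h = s - cos t * g\<close> and eliminating \<open>sin t\<close>
  makes \<open>cos t\<close> a root of a polynomial of degree 2 with leading coefficient
  \<open>g\<^sup>2 + h\<^sup>2\<close>, and \<open>cos\<close> is injective on
  \<open>{0..pi}\<close>. Hence an arc that starts off the origin meets a finite exceptional set
  only finitely often.\<close>

lemma finite_trig_eq: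
  fixes g h s :: real
  assumes "(g, h) \<noteq> (0, 0)"
  shows "finite {t \<in> {0..pi}. cos t * g + sin t * h = s}"
proof -
  let ?p = "[:s\<^sup>2 - h\<^sup>2, - 2 * s * g, g\<^sup>2 + h\<^sup>2:]"
  have "?p \<noteq> 0" using assms by (auto simp: sum_power2_eq_zero_iff)
  then have "finite {c. poly ?p c = 0}" by (rule poly_roots_finite)
  moreover have "cos ` {t \<in> {0..pi}. cos t * g + sin t * h = s} \<subseteq> {c. poly ?p c = 0}"
  proof
    fix c assume "c \<in> cos ` {t \<in> {0..pi}. cos t * g + sin t * h = s}"
    then obtain t where t: "c = cos t" "s = cos t * g + sin t * h" by auto
    have "(sin t)\<^sup>2 = 1 - (cos t)\<^sup>2" by (simp add: sin_squared_eq)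
    then have "(cos t * g + sin t * h)\<^sup>2 - h\<^sup>2 +
           cos t * (cos t * (g\<^sup>2 + h\<^sup>2) - 2 * (cos t * g + sin t * h) * g) = 0"
      by algebra
    then show "c \<in> {c. poly ?p c = 0}" by (simp add: t algebra_simps)
  qed
  ultimately have "finite (cos ` {t \<in> {0..pi}. cos t * g + sin t * h = s})"
    by (rule finite_subset[rotated])
  then show ?thesis
    by (rule finite_imageD) (auto intro: inj_onI cos_inj_pi)
qed

section \<open>Moments, marginals and null sets of the Gaussian pair\<close>

abbreviation std_normal_pair :: "(real \<times> real) measure" where
  "std_normal_pair \<equiv> std_normal_distribution \<Otimes>\<^sub>M std_normal_distribution"

lemma nn_integral_eq_has_bochner_integral:
  fixes f :: "'a \<Rightarrow> real"
  assumes "has_bochner_integral M f x" "\<And>p. 0 \<le> f p"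
  shows "(\<integral>\<^sup>+p. ennreal (f p) \<partial>M) = ennreal x"
  using assms by (simp add: nn_integral_eq_integral has_bochner_integral_iff)

lemma nn_integral_std_normal_square:
  "(\<integral>\<^sup>+h. ennreal (h\<^sup>2) \<partial>std_normal_distribution) = 1"
proof -
  have "(\<integral>\<^sup>+h. ennreal (h\<^sup>2) \<partial>std_normal_distribution) =
      (\<integral>\<^sup>+h. ennreal (std_normal_density h * h ^ (2 * 1)) \<partial>lborel)"
    by (simp add: nn_integral_density ennreal_mult)
  also have "\<dots> = ennreal (fact (2 * 1) / (2 ^ 1 * fact 1))"
    by (rule nn_integral_eq_has_bochner_integral[OF std_normal_moment_even[of 1]]) simp
  finally show ?thesis by (simp add: fact_numeral)
qed

lemma nn_integral_std_normal_fst: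
  assumes [measurable]: "f \<in> borel_measurable borel"
  shows "(\<integral>\<^sup>+p. f (fst p) \<partial>std_normal_pair) = (\<integral>\<^sup>+g. f g \<partial>std_normal_distribution)"
proof -
  interpret N: real_distribution std_normal_distribution by (rule real_dist_normal_dist)
  show ?thesis
    by (subst N.nn_integral_fst[symmetric]) (simp_all add: N.emeasure_space_1[simplified])
qed

text \<open>The second coordinate contributes its variance 1. It is the velocity of the arc at angle
  0, so with \<open>f\<close> the squared derivative this is the mean squared speed of
  \<open>\<phi>\<close> along the arc.\<close>

lemma nn_integral_std_normal_fst_snd_square:
  assumes [measurable]: "f \<in> borel_measurable borel"
  shows "(\<integral>\<^sup>+p. f (fst p) * ennreal ((snd p)\<^sup>2) \<partial>std_normal_pair) =
    (\<integral>\<^sup>+g. f g \<partial>std_normal_distribution)"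
proof -
  interpret N: real_distribution std_normal_distribution by (rule real_dist_normal_dist)
  show ?thesis
    by (subst N.nn_integral_fst[symmetric])
      (simp_all add: nn_integral_cmult nn_integral_std_normal_square)
qed

lemma AE_std_normal_notin:
  assumes "finite S" shows "AE g in std_normal_distribution. g \<notin> S"
proof -
  have "AE g in lborel. g \<notin> S"
    by (rule AE_not_in) (rule finite_imp_null_set_lborel[OF assms])
  then show ?thesis by (subst AE_density) auto
qed

section \<open>One-sided derivative of the dual activation at 1\<close>

context
  fixes \<phi> \<phi>' :: "real \<Rightarrow> real" and S :: "real set"
  assumes cont: "continuous_on UNIV \<phi>"
    and fin: "finite S"
    and deriv: "\<And>t. t \<notin> S \<Longrightarrow> (\<phi> has_real_derivative \<phi>' t) (at t)"
    and meas: "(\<lambda>t. (\<phi>' t)\<^sup>2) \<in> borel_measurable borel"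
begin

lemma \<phi>_measurable [measurable]: "\<phi> \<in> borel_measurable borel"
  using cont by (rule borel_measurable_continuous_onI)

text \<open>Position \<open>cos t * g + sin t * h\<close> and velocity
  \<open>cos t * h - sin t * g\<close> on the arc form a rotation of \<open>(g, h)\<close>, so the
  mean squared speed is the same for every angle \<open>t\<close>. Integrating it over
  \<open>{0..\<theta>}\<close> gives one factor \<open>\<theta>\<close>; Cauchy-Schwarz gives the
  other.\<close>

lemma nn_integral_increment_le:
  assumes "0 \<le> \<theta>" "\<theta> \<le> pi"
  shows "(\<integral>\<^sup>+p. ennreal ((\<phi> (cos \<theta> * fst p + sin \<theta> * snd p) - \<phi> (fst p))\<^sup>2) \<partial>std_normal_pair)
    \<le> ennreal (\<theta>\<^sup>2) * (\<integral>\<^sup>+g. ennreal ((\<phi>' g)\<^sup>2) \<partial>std_normal_distribution)"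
proof -
  interpret N: real_distribution std_normal_distribution by (rule real_dist_normal_dist)
  interpret P: pair_prob_space std_normal_distribution std_normal_distribution ..
  interpret Q: pair_sigma_finite lborel std_normal_pair ..
  define q where "q t = ennreal ((\<phi>' t)\<^sup>2)" for t
  have q [measurable]: "q \<in> borel_measurable borel"
    unfolding q_def using meas by measurable
  let ?D = "\<integral>\<^sup>+g. q g \<partial>std_normal_distribution"
  let ?E = "\<lambda>t g h. q (cos t * g + sin t * h) * ennreal ((cos t * h - sin t * g)\<^sup>2)"
  have E_eq: "?E t g h = ennreal ((\<phi>' (cos t * g + sin t * h) * (cos t * h - sin t * g))\<^sup>2)" for t g h
    by (simp add: q_def power_mult_distrib ennreal_mult)
  have pw: "ennreal ((\<phi> (cos \<theta> * g + sin \<theta> * h) - \<phi> g)\<^sup>2) \<le>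
      ennreal \<theta> * (\<integral>\<^sup>+t. indicator {0..\<theta>} t * ?E t g h \<partial>lborel)" for g h
  \<comment> \<open>At the origin the arc is stationary and the increment is 0. Elsewhere the arc
    has only finitely many parameters with value in \<open>S\<close>.\<close>
  proof (cases "(g, h) = (0, 0)")
    case False
    let ?F = "\<lambda>t. \<phi> (cos t * g + sin t * h)"
    let ?T = "\<Union>s\<in>S. {t \<in> {0..pi}. cos t * g + sin t * h = s}"
    have "ennreal ((?F \<theta> - ?F 0)\<^sup>2) \<le> ennreal (\<theta> - 0) *
       (\<integral>\<^sup>+t. indicator {0..\<theta>} t *
         ennreal ((\<phi>' (cos t * g + sin t * h) * (cos t * h - sin t * g))\<^sup>2) \<partial>lborel)"
    proof (rule square_increment_le_energy[of ?T])
      show "finite ?T" using fin finite_trig_eq[OF False] by blast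
      show "continuous_on {0..\<theta>} ?F"
        by (intro continuous_on_compose2[OF cont] continuous_intros) auto
      have "(\<lambda>t. (\<phi>' (cos t * g + sin t * h))\<^sup>2 * (cos t * h - sin t * g)\<^sup>2) \<in> borel_measurable borel"
        by (intro borel_measurable_times measurable_compose[OF _ meas]) measurable
      then show "(\<lambda>t. (\<phi>' (cos t * g + sin t * h) * (cos t * h - sin t * g))\<^sup>2) \<in> borel_measurable borel"
        by (simp add: power_mult_distrib)
      fix t assume t: "t \<in> {0<..<\<theta>} - ?T"
      then have "cos t * g + sin t * h \<notin> S" using assms by auto
      then show "(?F has_real_derivative \<phi>' (cos t * g + sin t * h) * (cos t * h - sin t * g)) (at t)"
        by (intro DERIV_chain2[of \<phi>] deriv) (auto intro!: derivative_eq_intros)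
    qed (use assms in auto)
    then show ?thesis by (simp add: E_eq)
  qed simp
  have "(\<integral>\<^sup>+p. ennreal ((\<phi> (cos \<theta> * fst p + sin \<theta> * snd p) - \<phi> (fst p))\<^sup>2) \<partial>std_normal_pair)
    \<le> (\<integral>\<^sup>+p. ennreal \<theta> * (\<integral>\<^sup>+t. indicator {0..\<theta>} t * ?E t (fst p) (snd p) \<partial>lborel) \<partial>std_normal_pair)"
    by (intro nn_integral_mono pw)
  also have "\<dots> = ennreal \<theta> * (\<integral>\<^sup>+p. \<integral>\<^sup>+t. indicator {0..\<theta>} t * ?E t (fst p) (snd p) \<partial>lborel \<partial>std_normal_pair)"
    by (rule nn_integral_cmult) measurable
  also have "(\<integral>\<^sup>+p. \<integral>\<^sup>+t. indicator {0..\<theta>} t * ?E t (fst p) (snd p) \<partial>lborel \<partial>std_normal_pair)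
      = (\<integral>\<^sup>+t. \<integral>\<^sup>+p. indicator {0..\<theta>} t * ?E t (fst p) (snd p) \<partial>std_normal_pair \<partial>lborel)"
    by (rule Q.Fubini') measurable
  also have "\<dots> = (\<integral>\<^sup>+t. ?D * indicator {0..\<theta>} t \<partial>lborel)"
  proof (rule nn_integral_cong_AE)
    show "AE t in lborel. (\<integral>\<^sup>+p. indicator {0..\<theta>} t * ?E t (fst p) (snd p) \<partial>std_normal_pair) =
        ?D * indicator {0..\<theta>} t"
      \<comment> \<open>The rotation lemma asks for \<open>sin t \<noteq> 0\<close>; the zeros 0 and
        \<open>pi\<close> form a null set.\<close>
      using AE_lborel_singleton[of 0] AE_lborel_singleton[of pi]
    proof eventually_elim
      case (elim t)
      show ?case
      proof (cases "t \<in> {0..\<theta>}")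
        case True
        then have "sin t \<noteq> 0" using elim assms sin_gt_zero[of t] by auto
        then have "(\<integral>\<^sup>+p. ?E t (fst p) (snd p) \<partial>std_normal_pair) =
            (\<integral>\<^sup>+p. q (fst p) * ennreal ((snd p)\<^sup>2) \<partial>std_normal_pair)"
          using nn_integral_std_normal_rotate[of "\<lambda>p. q (fst p) * ennreal ((snd p)\<^sup>2)" "cos t" "sin t"]
          by simp
        then show ?thesis using True by (simp add: nn_integral_std_normal_fst_snd_square)
      qed simp
    qed
  qed
  also have "\<dots> = ?D * ennreal \<theta>"
    using assms by (simp add: nn_integral_cmult)
  finally show ?thesis
    using assms by (simp add: q_def power2_eq_square ennreal_mult ac_simps)
qed

text \<open>Fatou's lemma. Almost surely \<open>fst p\<close> avoids the finite set
  \<open>S\<close>, and there the difference quotient in the angle tends to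
  \<open>\<phi>' (fst p) * snd p\<close>.\<close>

lemma nn_integral_increment_liminf:
  assumes pos: "\<And>n. 0 < \<theta> n" and lim: "\<theta> \<longlonglongrightarrow> 0"
  shows "(\<integral>\<^sup>+g. ennreal ((\<phi>' g)\<^sup>2) \<partial>std_normal_distribution) \<le>
    liminf (\<lambda>n. \<integral>\<^sup>+p. ennreal (((\<phi> (cos (\<theta> n) * fst p + sin (\<theta> n) * snd p) - \<phi> (fst p)) / \<theta> n)\<^sup>2)
      \<partial>std_normal_pair)"
proof -
  interpret N: real_distribution std_normal_distribution by (rule real_dist_normal_dist)
  interpret P: pair_prob_space std_normal_distribution std_normal_distribution ..
  let ?Q = "\<lambda>n p. ((\<phi> (cos (\<theta> n) * fst p + sin (\<theta> n) * snd p) - \<phi> (fst p)) / \<theta> n)\<^sup>2"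
  have q [measurable]: "(\<lambda>t. ennreal ((\<phi>' t)\<^sup>2)) \<in> borel_measurable borel"
    using meas by measurable
  have [measurable]: "S \<in> sets borel" using fin by (simp add: finite_imp_closed)
  have \<theta>_at: "filterlim \<theta> (at 0) sequentially"
    using lim pos by (auto simp: filterlim_at less_imp_neq[symmetric])
  have "AE p in std_normal_pair. fst p \<notin> S"
  proof (rule P.AE_pair_measure)
    show "{p \<in> space std_normal_pair. fst p \<notin> S} \<in> sets std_normal_pair"
      by measurable
  qed (use AE_std_normal_notin[OF fin] in auto)
  then have "AE p in std_normal_pair.
      ennreal ((\<phi>' (fst p))\<^sup>2) * ennreal ((snd p)\<^sup>2) \<le> liminf (\<lambda>n. ennreal (?Q n p))"
  proof eventually_elim
    case (elim p)
    have "((\<lambda>t. \<phi> (cos t * fst p + sin t * snd p)) has_real_derivative \<phi>' (fst p) * snd p) (at 0)"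
      by (rule DERIV_chain2[of \<phi>]) (use deriv[OF elim] in \<open>auto intro!: derivative_eq_intros\<close>)
    then have "((\<lambda>t. (\<phi> (cos t * fst p + sin t * snd p) - \<phi> (fst p)) / t) \<longlongrightarrow> \<phi>' (fst p) * snd p) (at 0)"
      by (simp add: has_field_derivative_iff)
    from filterlim_compose[OF this \<theta>_at]
    have "(\<lambda>n. ennreal (?Q n p)) \<longlonglongrightarrow> ennreal ((\<phi>' (fst p) * snd p)\<^sup>2)"
      by (intro tendsto_ennrealI tendsto_power)
    then have "liminf (\<lambda>n. ennreal (?Q n p)) = ennreal ((\<phi>' (fst p) * snd p)\<^sup>2)"
      by (intro lim_imp_Liminf) simp_all
    then show ?case by (simp add: power_mult_distrib ennreal_mult)
  qed
  then have "(\<integral>\<^sup>+p. ennreal ((\<phi>' (fst p))\<^sup>2) * ennreal ((snd p)\<^sup>2) \<partial>std_normal_pair)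
      \<le> (\<integral>\<^sup>+p. liminf (\<lambda>n. ennreal (?Q n p)) \<partial>std_normal_pair)"
    by (rule nn_integral_mono_AE)
  also have "\<dots> \<le> liminf (\<lambda>n. \<integral>\<^sup>+p. ennreal (?Q n p) \<partial>std_normal_pair)"
    by (rule nn_integral_liminf) measurable
  finally show ?thesis
    using nn_integral_std_normal_fst_snd_square[OF q] by simp
qed

context
  assumes norm_int: "integrable std_normal_distribution (\<lambda>t. (\<phi> t)\<^sup>2)"
    and norm: "(\<integral>t. (\<phi> t)\<^sup>2 \<partial>std_normal_distribution) = 1"
begin

lemma has_bochner_integral_square_fst:
  "has_bochner_integral std_normal_pair (\<lambda>p. (\<phi> (fst p))\<^sup>2) 1"
proof (rule has_bochner_integral_nn_integral)
  show "(\<integral>\<^sup>+p. ennreal ((\<phi> (fst p))\<^sup>2) \<partial>std_normal_pair) = ennreal 1"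
    using nn_integral_std_normal_fst[of "\<lambda>g. ennreal ((\<phi> g)\<^sup>2)"]
    by (simp add: nn_integral_eq_integral[OF norm_int] norm)
qed auto

lemma dual_activation_eq:
  "dual_activation \<phi> z = (\<integral>p. \<phi> (fst p) * \<phi> (z * fst p + sqrt (1 - z\<^sup>2) * snd p) \<partial>std_normal_pair)"
proof -
  have "(\<lambda>p. \<phi> (fst p) * \<phi> (snd p)) \<in> borel_measurable (borel :: (real \<times> real) measure)"
    unfolding borel_prod[symmetric] by measurable
  then show ?thesis
    unfolding dual_activation_def gaussian_pair_def
    by (subst integral_distr) (auto simp: case_prod_beta')
qed

lemma dual_activation_one: "dual_activation \<phi> 1 = 1"
  using has_bochner_integral_integral_eq[OF has_bochner_integral_square_fst]
  by (simp add: dual_activation_eq power2_eq_square)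

text \<open>Expand the square. Both squares have mean 1, the rotated one by rotation invariance, and
  the mixed term is the dual activation because
  \<open>sqrt (1 - (cos \<theta>)\<^sup>2) = sin \<theta>\<close> between 0 and
  \<open>pi\<close>.\<close>

lemma has_bochner_integral_increment:
  assumes \<theta>: "0 < \<theta>" "\<theta> < pi"
  shows "has_bochner_integral std_normal_pair
    (\<lambda>p. (\<phi> (cos \<theta> * fst p + sin \<theta> * snd p) - \<phi> (fst p))\<^sup>2) (2 - 2 * dual_activation \<phi> (cos \<theta>))"
proof -
  let ?u = "\<lambda>p. \<phi> (fst p)" and ?v = "\<lambda>p. \<phi> (cos \<theta> * fst p + sin \<theta> * snd p)"
  have s: "sin \<theta> > 0" using \<theta> by (rule sin_gt_zero)
  have u: "has_bochner_integral std_normal_pair (\<lambda>p. (?u p)\<^sup>2) 1"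
    by (rule has_bochner_integral_square_fst)
  have v: "has_bochner_integral std_normal_pair (\<lambda>p. (?v p)\<^sup>2) 1"
  proof (rule has_bochner_integral_nn_integral)
    show "(\<integral>\<^sup>+p. ennreal ((?v p)\<^sup>2) \<partial>std_normal_pair) = ennreal 1"
      using nn_integral_std_normal_rotate[of "\<lambda>p. ennreal ((\<phi> (fst p))\<^sup>2)" "cos \<theta>" "sin \<theta>"] s
      using nn_integral_std_normal_fst[of "\<lambda>g. ennreal ((\<phi> g)\<^sup>2)"]
    by (simp add: nn_integral_eq_integral[OF norm_int] norm)
  qed auto
  have "integrable std_normal_pair (\<lambda>p. (?u p)\<^sup>2 + (?v p)\<^sup>2)"
    using u v by (auto simp: has_bochner_integral_iff)
  then have uv: "integrable std_normal_pair (\<lambda>p. ?u p * ?v p)"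
  proof (rule Bochner_Integration.integrable_bound)
    show "AE p in std_normal_pair. norm (?u p * ?v p) \<le> norm ((?u p)\<^sup>2 + (?v p)\<^sup>2)"
    proof (rule AE_I2)
      fix p
      have "2 * \<bar>?u p * ?v p\<bar> \<le> (?u p)\<^sup>2 + (?v p)\<^sup>2"
        using sum_squares_bound[of "\<bar>?u p\<bar>" "\<bar>?v p\<bar>"] by (simp add: abs_mult mult.assoc)
      then show "norm (?u p * ?v p) \<le> norm ((?u p)\<^sup>2 + (?v p)\<^sup>2)"
        by simp
    qed
  qed measurable
  have sq: "sqrt (1 - (cos \<theta>)\<^sup>2) = sin \<theta>"
    using s by (simp add: sin_squared_eq[symmetric])
  have uv': "has_bochner_integral std_normal_pair (\<lambda>p. ?u p * ?v p) (dual_activation \<phi> (cos \<theta>))"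
    using uv by (simp add: has_bochner_integral_iff dual_activation_eq sq)
  have "has_bochner_integral std_normal_pair (\<lambda>p. (?v p)\<^sup>2 + (?u p)\<^sup>2 - 2 * (?u p * ?v p))
     (1 + 1 - 2 * dual_activation \<phi> (cos \<theta>))"
    using u v uv' by (intro has_bochner_integral_diff has_bochner_integral_add has_bochner_integral_mult_right)
  then show ?thesis by (simp add: power2_diff ac_simps)
qed

text \<open>With \<open>z = cos \<theta>\<close>, the difference quotient at 1 is the mean squared
  difference quotient in the angle times \<open>\<theta>\<^sup>2 / (2 * (1 - cos \<theta>))\<close>.
  The first factor is squeezed to the mean of the squared derivative, the second tends to 1.\<close>

lemma dual_activation_has_derivative_at_one:
  assumes D_int: "integrable std_normal_distribution (\<lambda>t. (\<phi>' t)\<^sup>2)"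
  shows "(dual_activation \<phi> has_real_derivative (\<integral>t. (\<phi>' t)\<^sup>2 \<partial>std_normal_distribution))
    (at 1 within {-1..1})"
proof -
  let ?f = "dual_activation \<phi>"
  define D where "D = (\<integral>t. (\<phi>' t)\<^sup>2 \<partial>std_normal_distribution)"
  have D0: "0 \<le> D" unfolding D_def by simp
  have DD: "(\<integral>\<^sup>+g. ennreal ((\<phi>' g)\<^sup>2) \<partial>std_normal_distribution) = ennreal D"
    unfolding D_def using D_int by (intro nn_integral_eq_integral) auto
  have "((\<lambda>z. (?f z - ?f 1) / (z - 1)) \<longlongrightarrow> D) (at_left 1)"
  \<comment> \<open>Any lower bound in \<open>{-1..<1}\<close> would do; 0 keeps the sequence inside
    the domain of \<open>arccos\<close>.\<close>
  proof (rule tendsto_at_left_sequentially[of 0])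
    fix z :: "nat \<Rightarrow> real"
    assume z: "\<And>n. z n < 1" "\<And>n. 0 < z n" "z \<longlonglongrightarrow> 1"
    define \<theta> where "\<theta> n = arccos (z n)" for n
    have cos: "cos (\<theta> n) = z n" for n
      unfolding \<theta>_def using z(1,2)[of n] by (intro cos_arccos) auto
    have \<theta>: "0 < \<theta> n" "\<theta> n < pi" for n
      using arccos_lt_bounded[of "z n"] z(1,2)[of n] unfolding \<theta>_def by auto
    have "(\<lambda>n. arccos (z n)) \<longlonglongrightarrow> arccos 1"
      using z(3) less_imp_le[OF z(1)] order_trans[OF _ less_imp_le[OF z(2)], of "-1"]
      by (intro continuous_on_tendsto_compose[OF continuous_on_arccos']) auto
    then have \<theta>0: "\<theta> \<longlonglongrightarrow> 0" by (simp add: \<theta>_def[abs_def])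
    define R where "R n = (2 - 2 * ?f (z n)) / (\<theta> n)\<^sup>2" for n
    have R: "has_bochner_integral std_normal_pair
        (\<lambda>p. ((\<phi> (cos (\<theta> n) * fst p + sin (\<theta> n) * snd p) - \<phi> (fst p)) / \<theta> n)\<^sup>2) (R n)" for n
      using has_bochner_integral_divide_zero[where c = "(\<theta> n)\<^sup>2",
          OF has_bochner_integral_increment[OF \<theta>(1)[of n] \<theta>(2)[of n]]]
      by (simp add: power_divide R_def cos)
    have R0: "0 \<le> R n" for n
      using has_bochner_integral_integral_eq[OF R[of n], symmetric] by simp
    have nnR: "(\<integral>\<^sup>+p. ennreal (((\<phi> (cos (\<theta> n) * fst p + sin (\<theta> n) * snd p) - \<phi> (fst p)) / \<theta> n)\<^sup>2)
        \<partial>std_normal_pair) = ennreal (R n)" for n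
      by (rule nn_integral_eq_has_bochner_integral[OF R]) simp
    have low: "ennreal D \<le> liminf (\<lambda>n. ennreal (R n))"
      using nn_integral_increment_liminf[OF \<theta>(1) \<theta>0] unfolding DD nnR .
    have up: "ennreal (R n) \<le> ennreal D" for n
    proof -
      have "ennreal (2 - 2 * ?f (cos (\<theta> n))) \<le> ennreal ((\<theta> n)\<^sup>2) * ennreal D"
        using nn_integral_increment_le[of "\<theta> n"] \<theta>[of n] DD
          nn_integral_eq_has_bochner_integral[OF has_bochner_integral_increment[OF \<theta>, of n]] by simp
      then have "2 - 2 * ?f (cos (\<theta> n)) \<le> (\<theta> n)\<^sup>2 * D"
        using D0 by (simp add: ennreal_mult[symmetric] ennreal_le_iff)
      then show ?thesis using \<theta>(1)[of n]
        by (intro ennreal_leI) (simp add: R_def cos field_simps)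
    qed
    have "limsup (\<lambda>n. ennreal (R n)) \<le> ennreal D"
      by (intro Limsup_bounded always_eventually allI up)
    then have "(\<lambda>n. ennreal (R n)) \<longlonglongrightarrow> ennreal D"
      using low Liminf_le_Limsup[of sequentially "\<lambda>n. ennreal (R n)"]
      by (intro iffD2[OF tendsto_iff_Liminf_eq_Limsup]) auto
    then have RD: "R \<longlonglongrightarrow> D"
      by (rule tendsto_ennrealD) (use D0 R0 in auto)
    \<comment> \<open>Change of variable from the angle back to \<open>z\<close>, by the half-angle
      identity \<open>1 - cos \<theta> = 2 * (sin (\<theta> / 2))\<^sup>2\<close>.\<close>
    have "((\<lambda>t::real. sin t / t) \<longlongrightarrow> 1) (at 0)"
      using DERIV_sin[of "0::real"] by (simp add: has_field_derivative_iff)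
    moreover have "filterlim (\<lambda>n. \<theta> n / 2) (at 0) sequentially"
      using tendsto_divide[OF \<theta>0 tendsto_const[of 2]] \<theta>(1)
      by (auto simp: filterlim_at less_imp_neq[symmetric])
    ultimately have "(\<lambda>n. sin (\<theta> n / 2) / (\<theta> n / 2)) \<longlonglongrightarrow> 1"
      by (rule filterlim_compose)
    then have "(\<lambda>n. 1 / (sin (\<theta> n / 2) / (\<theta> n / 2))\<^sup>2) \<longlonglongrightarrow> 1 / 1\<^sup>2"
      by (intro tendsto_intros) auto
    moreover have "1 / (sin (\<theta> n / 2) / (\<theta> n / 2))\<^sup>2 = (\<theta> n)\<^sup>2 / (2 * (1 - cos (\<theta> n)))" for n
      using cos_double_sin[of "\<theta> n / 2"] by (simp add: power_divide)
    ultimately have "(\<lambda>n. (\<theta> n)\<^sup>2 / (2 * (1 - cos (\<theta> n)))) \<longlonglongrightarrow> 1" by simp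
    from tendsto_mult[OF RD this]
    have "(\<lambda>n. R n * ((\<theta> n)\<^sup>2 / (2 * (1 - z n)))) \<longlonglongrightarrow> D"
      by (simp add: cos)
    moreover have "R n * ((\<theta> n)\<^sup>2 / (2 * (1 - z n))) = (?f (z n) - ?f 1) / (z n - 1)" for n
      using \<theta>(1)[of n] z(1)[of n] by (simp add: R_def dual_activation_one field_simps)
    ultimately show "(\<lambda>n. (?f (z n) - ?f 1) / (z n - 1)) \<longlonglongrightarrow> D" by simp
  qed simp
  then show ?thesis
    by (simp add: has_field_derivative_iff D_def at_within_Icc_at_left)
qed

text \<open>All iterates of the dual activation fix 1, so on the diagonal the recursion reads
  \<open>K (Suc L) = 1 + K L * D\<close> with \<open>D \<ge> 0\<close>, starting from
  \<open>K 0 = 1\<close>.\<close>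

lemma ntk_one_ge_one:
  assumes "integrable std_normal_distribution (\<lambda>t. (\<phi>' t)\<^sup>2)"
  shows "1 \<le> ntk \<phi> L 1"
proof -
  have "vector_derivative (dual_activation \<phi>) (at 1 within cbox (-1) 1) =
      (\<integral>t. (\<phi>' t)\<^sup>2 \<partial>std_normal_distribution)"
    using dual_activation_has_derivative_at_one[OF assms]
    by (intro vector_derivative_within_cbox) (auto simp: has_real_derivative_iff_has_vector_derivative)
  then have "0 \<le> dual_activation_deriv \<phi> 1"
    by (simp add: dual_activation_deriv_def)
  moreover have "(dual_activation \<phi> ^^ L) 1 = 1" for L
    by (induction L) (auto simp: dual_activation_one)
  ultimately show ?thesis by (induction L) (simp_all add: dual_activation_one)
qed

end

end

section \<open>Limits of rescaled linear systems\<close>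

lemma tendsto_det:
  fixes A :: "'b \<Rightarrow> real ^ 'n ^ 'n"
  assumes "\<And>i j. ((\<lambda>x. A x $ i $ j) \<longlongrightarrow> A0 $ i $ j) F"
  shows "((\<lambda>x. det (A x)) \<longlongrightarrow> det A0) F"
  unfolding det_def by (intro tendsto_intros assms)

lemma matrix_vector_mult_scaleR_left:
  fixes A :: "real ^ 'n ^ 'm"
  shows "(\<chi> i j. c * A $ i $ j) *v x = c *\<^sub>R (A *v x)"
  by (simp add: vec_eq_iff matrix_vector_mult_def sum_distrib_left mult.assoc)

text \<open>Matrix and vector may have different scales \<open>a\<close> and \<open>c\<close>: the
  solution of the original system is \<open>c L / a L\<close> times that of the rescaled one, and
  \<open>sgn\<close> ignores a positive factor. Rescaled solutions converge to \<open>w\<close> by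
  Cramer's rule, and \<open>sgn\<close> is continuous at
  \<open>y \<bullet> w \<noteq> 0\<close>.\<close>

lemma rescaled_kernel_limit:
  fixes K :: "nat \<Rightarrow> real ^ 'n::finite ^ 'n" and k :: "nat \<Rightarrow> real ^ 'n"
  assumes a: "\<forall>\<^sub>F L in sequentially. 0 < a L" and c: "\<forall>\<^sub>F L in sequentially. 0 < c L"
    and K: "\<And>i j. (\<lambda>L. K L $ i $ j / a L) \<longlonglongrightarrow> A $ i $ j"
    and k: "\<And>i. (\<lambda>L. k L $ i / c L) \<longlonglongrightarrow> b $ i"
    and A: "invertible A" and w: "A *v w = b" and yw: "y \<bullet> w \<noteq> 0"
  shows "\<forall>\<^sub>F L in sequentially. invertible (K L)"
    and "(\<lambda>L. sgn ((y v* matrix_inv (K L)) \<bullet> k L)) \<longlonglongrightarrow> sgn (y \<bullet> w)"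
proof -
  define B where "B L = (\<chi> i j. inverse (a L) * K L $ i $ j)" for L
  define q where "q L = (\<chi> i. k L $ i / c L)" for L
  \<comment> \<open>Cramer's quotients make the dependence on the entries continuous. Division by
    zero yields 0 where \<open>det (B L) = 0\<close>, which happens for finitely many
    \<open>L\<close> only.\<close>
  define u where "u L = (\<chi> l. det (\<chi> i j. if j = l then q L $ i else B L $ i $ j) / det (B L))" for L
  have B: "(\<lambda>L. B L $ i $ j) \<longlonglongrightarrow> A $ i $ j" for i j
    using K[of i j] by (simp add: B_def field_simps)
  have q: "(\<lambda>L. q L $ i) \<longlonglongrightarrow> b $ i" for i
    using k[of i] by (simp add: q_def)
  have dA: "det A \<noteq> 0" using A by (simp add: invertible_det_nz)
  have dB: "(\<lambda>L. det (B L)) \<longlonglongrightarrow> det A" by (rule tendsto_det[OF B])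
  have w_eq: "w = (\<chi> l. det (\<chi> i j. if j = l then b $ i else A $ i $ j) / det A)"
    using cramer[OF dA] w by blast
  have u_lim: "(\<lambda>L. y \<bullet> u L) \<longlonglongrightarrow> y \<bullet> w"
  proof (rule tendsto_inner[OF tendsto_const], rule vec_tendstoI)
    fix l
    have "(\<lambda>L. det (\<chi> i j. if j = l then q L $ i else B L $ i $ j)) \<longlonglongrightarrow>
        det (\<chi> i j. if j = l then b $ i else A $ i $ j)"
      by (rule tendsto_det) (auto intro: B q)
    then show "(\<lambda>L. u L $ l) \<longlonglongrightarrow> w $ l"
      by (subst w_eq) (simp add: u_def tendsto_divide dB dA)
  qed
  have good: "\<forall>\<^sub>F L in sequentially. invertible (K L) \<and>
      sgn (y \<bullet> u L) = sgn ((y v* matrix_inv (K L)) \<bullet> k L)"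
    using a c tendsto_imp_eventually_ne[OF dB dA]
  proof eventually_elim
    case (elim L)
    have KB: "K L *v x = a L *\<^sub>R (B L *v x)" for x
      using elim(1) unfolding B_def matrix_vector_mult_scaleR_left by simp
    have "invertible (B L)" using elim(3) by (simp add: invertible_det_nz)
    then have "\<forall>x. B L *v x = 0 \<longrightarrow> x = 0"
      by (metis invertible_def matrix_left_invertible_ker)
    then have inv: "invertible (K L)"
      unfolding invertible_left_inverse matrix_left_invertible_ker KB using elim(1) by simp
    define x where "x = matrix_inv (K L) *v k L"
    have "K L ** matrix_inv (K L) = mat 1"
      using inv unfolding invertible_def matrix_inv_def by (rule someI2_ex) blast
    then have "K L *v x = k L"
      by (simp add: x_def matrix_vector_mul_assoc)
    then have Kx: "a L *\<^sub>R (B L *v x) = k L" by (simp add: KB)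
    have "B L *v ((a L / c L) *\<^sub>R x) = (1 / c L) *\<^sub>R (a L *\<^sub>R (B L *v x))"
      by (simp add: matrix_vector_mult_scaleR)
    also have "\<dots> = q L"
      unfolding Kx by (simp add: q_def vec_eq_iff)
    finally have "(a L / c L) *\<^sub>R x = u L"
      unfolding u_def using cramer[OF elim(3)] by blast
    then have "y \<bullet> u L = (a L / c L) * (y \<bullet> x)"
      by (metis inner_scaleR_right)
    then have "sgn (y \<bullet> u L) = sgn (y \<bullet> x)"
      using elim(1,2) by (simp add: sgn_mult)
    then show ?case using inv by (simp add: x_def dot_lmul_matrix)
  qed
  then show "\<forall>\<^sub>F L in sequentially. invertible (K L)" by eventually_elim simp
  show "(\<lambda>L. sgn ((y v* matrix_inv (K L)) \<bullet> k L)) \<longlonglongrightarrow> sgn (y \<bullet> w)"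
    by (rule Lim_transform_eventually[OF tendsto_sgn[OF u_lim yw]])
       (use good in eventually_elim, simp)
qed

text \<open>This is \<open>a I + c J\<close> with \<open>J\<close> the all-ones matrix. Summing the
  coordinates of a kernel vector, multiplied by the matrix, shows that its coordinate sum vanishes;
  then \<open>a * v $ i = 0\<close> for every \<open>i\<close>.\<close>

lemma invertible_diag_plus_const:
  fixes a c :: real
  assumes "a \<noteq> 0" "a + of_nat CARD('n::finite) * c \<noteq> 0"
  shows "invertible (\<chi> i j. if i = j then a + c else c :: real ^ 'n ^ 'n)"
proof -
  let ?A = "\<chi> i j. if i = j then a + c else c :: real ^ 'n ^ 'n"
  have mult: "(?A *v v) $ i = a * v $ i + c * (\<Sum>j\<in>UNIV. v $ j)" for v i
  proof -
    have "(?A *v v) $ i = (\<Sum>j\<in>UNIV. (if j = i then a * v $ i else 0) + c * v $ j)"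
      unfolding matrix_vector_mult_def by (auto intro!: sum.cong simp: algebra_simps)
    then show ?thesis by (simp add: sum.distrib sum_distrib_left)
  qed
  have "v = 0" if "?A *v v = 0" for v
  proof -
    have eq: "a * v $ i + c * (\<Sum>j\<in>UNIV. v $ j) = 0" for i
      using mult[of v i] that by simp
    then have "(\<Sum>i\<in>UNIV. a * v $ i + c * (\<Sum>j\<in>UNIV. v $ j)) = 0" by simp
    then have "(a + of_nat CARD('n) * c) * (\<Sum>j\<in>UNIV. v $ j) = 0"
      by (simp add: sum.distrib sum_distrib_left[symmetric] algebra_simps)
    then have "(\<Sum>j\<in>UNIV. v $ j) = 0" using assms(2) by simp
    then show "v = 0" using eq assms(1) by (simp add: vec_eq_iff)
  qed
  then show ?thesis
    unfolding invertible_left_inverse matrix_left_invertible_ker by blast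
qed

section \<open>The limiting classifier is the majority vote\<close>

lemma norm_nonneg_sphere: "u \<in> nonneg_sphere \<Longrightarrow> u \<bullet> u = 1"
  by (simp add: nonneg_sphere_def norm_eq_1)

text \<open>The finite set \<open>S\<close> admits activations with kinks such as ReLU, and the
  limit in \<open>ereal\<close> admits a diagonal that outgrows \<open>C\<close>. Distinct samples
  and a new query point reflect data with a density; a tie is excluded. Since
  \<open>matrix_inv\<close> and \<open>lim\<close> are total functions, eventual invertibility and
  convergence belong to the conclusion.\<close>

theorem proposition1:
  fixes \<phi> \<phi>' :: "real \<Rightarrow> real"
    and S :: "real set"
    and C :: "nat \<Rightarrow> real"
    and C1 :: real
    and X :: "'n::finite \<Rightarrow> real ^ 'd::finite"
    and y :: "real ^ 'n"
    and x :: "real ^ 'd"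
  assumes "continuous_on UNIV \<phi>"
    and "finite S"
    and "\<And>t. t \<notin> S \<Longrightarrow> (\<phi> has_real_derivative \<phi>' t) (at t)"
    and "integrable std_normal_distribution (\<lambda>t. (\<phi> t)\<^sup>2)"
    and "(\<integral>t. (\<phi> t)\<^sup>2 \<partial>std_normal_distribution) = 1"
    and "integrable std_normal_distribution (\<lambda>t. (\<phi>' t)\<^sup>2)"
    and "\<And>L. 0 < C L"
    and "0 < C1"
    and "\<And>u v :: real ^ 'd. u \<in> nonneg_sphere \<Longrightarrow> v \<in> nonneg_sphere \<Longrightarrow> u \<noteq> v \<Longrightarrow>
           (\<lambda>L. ntk \<phi> L (u \<bullet> v) / C L) \<longlonglongrightarrow> C1"
    and "\<And>u v :: real ^ 'd. u \<in> nonneg_sphere \<Longrightarrow> v \<in> nonneg_sphere \<Longrightarrow> u \<noteq> v \<Longrightarrow>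
           \<exists>C2 :: ereal. (\<lambda>L. ereal (ntk \<phi> L (u \<bullet> u) / C L)) \<longlonglongrightarrow> C2 \<and> C2 \<noteq> ereal C1"
    and "\<And>i. X i \<in> nonneg_sphere"
    and "inj X"
    and "\<And>i. y $ i \<in> {-1, 1}"
    and "x \<in> nonneg_sphere"
    and "x \<notin> range X"
    and "(\<Sum>i\<in>UNIV. y $ i) \<noteq> 0"
  shows "(\<forall>\<^sub>F L in sequentially. invertible (ntk_matrix \<phi> L X))
    \<and> convergent (ntk_sign \<phi> X y x)
    \<and> ntk_classifier \<phi> X y x = sgn (\<Sum>i\<in>UNIV. y $ i)"
proof -
  note C_pos = assms(7) and C1_pos = assms(8) and off_lim = assms(9)
  have "(\<lambda>t. (\<phi>' t)\<^sup>2) \<in> borel_measurable borel"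
    using borel_measurable_integrable[OF assms(6)] by simp
  then have diag: "1 \<le> ntk \<phi> L 1" for L
    using ntk_one_ge_one[OF assms(1-3) _ assms(4-6)] by blast
  have XX: "X i \<bullet> X i = 1" for i by (rule norm_nonneg_sphere[OF assms(11)])
  have Xne: "X i \<noteq> X j" if "i \<noteq> j" for i j using that assms(12) by (auto dest: injD)
  have xX: "X i \<noteq> x" for i using assms(15) by auto
  \<comment> \<open>On the unit sphere every diagonal entry is the kernel at 1, so a single
    \<open>C2\<close> serves all samples.\<close>
  obtain C2 :: ereal where C2: "(\<lambda>L. ereal (ntk \<phi> L 1 / C L)) \<longlonglongrightarrow> C2" "C2 \<noteq> ereal C1"
    using assms(10)[OF assms(11) assms(14) xX] unfolding XX by blast
  \<comment> \<open>Rules out a limit of minus infinity, and later a vanishing eigenvalue of the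
    limit matrix.\<close>
  have C2_nonneg: "0 \<le> C2"
  proof (rule tendsto_lowerbound[OF C2(1)])
    show "\<forall>\<^sub>F L in sequentially. 0 \<le> ereal (ntk \<phi> L 1 / C L)"
      using diag C_pos by (auto intro!: always_eventually divide_nonneg_pos intro: order_trans[OF zero_le_one])
  qed simp
  have vec_lim: "(\<lambda>L. ntk_vector \<phi> L X x $ i / C L) \<longlonglongrightarrow> (\<chi> i. C1) $ i" for i
    using off_lim[OF assms(11) assms(14) xX] by (simp add: ntk_vector_def)
  \<comment> \<open>The diagonal scale \<open>a\<close> differs from \<open>C\<close> when the diagonal dominates, or when there is no
     off-diagonal entry: for a single training point \<open>C2\<close> may be \<open>0\<close>.\<close>
  obtain a A r where a: "\<And>L. 0 < a L" and A: "invertible A" and r: "0 < r"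
    and Ar: "A *v (\<chi> i. r) = (\<chi> i. C1)"
    and mat_lim: "\<And>i j. (\<lambda>L. ntk_matrix \<phi> L X $ i $ j / a L) \<longlonglongrightarrow> A $ i $ j"
  proof (cases "CARD('n) = 1 \<or> C2 = \<infinity>")
    case True
    have "(\<lambda>L. ntk_matrix \<phi> L X $ i $ j / ntk \<phi> L 1) \<longlonglongrightarrow> (mat 1 :: real ^ 'n ^ 'n) $ i $ j" for i j
    proof (cases "i = j")
      case True
      have "ntk \<phi> L 1 \<noteq> 0" for L using diag[of L] by linarith
      then show ?thesis using True by (simp add: ntk_matrix_def XX mat_def)
    next
      case False
      \<comment> \<open>An off-diagonal entry requires two samples, so the case assumption leaves
        \<open>C2 = \<infinity>\<close>: the diagonal dominates.\<close>
      have "CARD('n) \<noteq> 1"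
        using False by (metis UNIV_I card_1_singletonE singletonD)
      then have "filterlim (\<lambda>L. ntk \<phi> L 1 / C L) at_top sequentially"
        using C2(1) \<open>CARD('n) = 1 \<or> C2 = \<infinity>\<close> by (simp add: tendsto_PInfty_eq_at_top)
      then have "(\<lambda>L. (ntk \<phi> L (X i \<bullet> X j) / C L) / (ntk \<phi> L 1 / C L)) \<longlonglongrightarrow> 0"
        by (intro real_tendsto_divide_at_top[OF off_lim] assms(11) Xne False)
      moreover have "C L \<noteq> 0" for L using C_pos[of L] by simp
      ultimately show ?thesis using False by (simp add: ntk_matrix_def mat_def)
    qed
    moreover have "0 < ntk \<phi> L 1" for L using diag[of L] by linarith
    ultimately show ?thesis
      using C1_pos by (intro that[of "\<lambda>L. ntk \<phi> L 1" "mat 1" C1]) (auto simp: invertible_det_nz)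
  next
    case False
    then obtain c where c: "C2 = ereal c" using C2_nonneg by (cases C2) auto
    have c0: "0 \<le> c" "c \<noteq> C1" using c C2 C2_nonneg by auto
    \<comment> \<open>With at least two samples,
      \<open>c - C1 + real CARD('n) * C1 \<ge> c + C1 > 0\<close>.\<close>
    have "CARD('n) > 0" by simp
    then have "2 \<le> CARD('n)" using False by linarith
    then have "2 * C1 \<le> real CARD('n) * C1"
      using C1_pos by (intro mult_right_mono) auto
    then have den: "0 < c - C1 + real CARD('n) * C1" using c0 C1_pos by linarith
    define A :: "real ^ 'n ^ 'n" where "A = (\<chi> i j. if i = j then (c - C1) + C1 else C1)"
    show ?thesis
    \<comment> \<open>All rows of \<open>A\<close> have the sum
      \<open>c - C1 + real CARD('n) * C1\<close>, so constant vectors are eigenvectors for it;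
      dividing \<open>C1\<close> by it solves the limit system.\<close>
    proof (rule that[of C A "C1 / (c - C1 + real CARD('n) * C1)"])
      show "invertible A"
        unfolding A_def using den c0 by (intro invertible_diag_plus_const) auto
      show "A *v (\<chi> i. C1 / (c - C1 + real CARD('n) * C1)) = (\<chi> i. C1)"
      proof (rule vec_eq_iff[THEN iffD2], rule allI)
        fix i
        have "(\<Sum>j\<in>UNIV. A $ i $ j) = (\<Sum>j\<in>UNIV. (if j = i then c - C1 else 0) + C1)"
          by (intro sum.cong) (auto simp: A_def)
        also have "\<dots> = c - C1 + real CARD('n) * C1" by (simp add: sum.distrib)
        finally show "(A *v (\<chi> i. C1 / (c - C1 + real CARD('n) * C1))) $ i = (\<chi> i. C1) $ i"
          using den unfolding matrix_vector_mult_def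
          by (simp add: sum_divide_distrib[symmetric] sum_distrib_right[symmetric])
      qed
      show "(\<lambda>L. ntk_matrix \<phi> L X $ i $ j / C L) \<longlonglongrightarrow> A $ i $ j" for i j
      proof (cases "i = j")
        case True
        then show ?thesis using C2(1) c by (simp add: ntk_matrix_def XX A_def)
      next
        case False
        then show ?thesis
          using off_lim[OF assms(11) assms(11) Xne[OF False]] by (simp add: ntk_matrix_def A_def)
      qed
    qed (use C_pos C1_pos den in auto)
  qed
  \<comment> \<open>The limit solution weights all samples equally and positively, so its pairing
    with the labels has the sign of the vote.\<close>
  have yw: "y \<bullet> (\<chi> i. r) = r * (\<Sum>i\<in>UNIV. y $ i)"
    by (simp add: inner_vec_def sum_distrib_left mult.commute)
  then have "y \<bullet> (\<chi> i. r) \<noteq> 0" using r assms(16) by simp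
  note lim = rescaled_kernel_limit[OF always_eventually always_eventually mat_lim vec_lim A Ar this]
  have "(\<lambda>L. ntk_sign \<phi> X y x L) \<longlonglongrightarrow> sgn (\<Sum>i\<in>UNIV. y $ i)"
    using lim(2) a C_pos r unfolding ntk_sign_def yw by (simp add: sgn_mult)
  moreover have "\<forall>\<^sub>F L in sequentially. invertible (ntk_matrix \<phi> L X)"
    using lim(1) a C_pos by blast
  ultimately show ?thesis
    unfolding ntk_classifier_def by (auto intro: convergentI limI)
qed

end
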